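(* Let $\tau_0,\tau_r\subset\mathbb R^3$ be flat (nondegenerate) triangles with unit normals $\boldsymbol n_0,\boldsymbol n_r$, and let $\Phi:\tau_0\to\tau_r$ be affine and bijective. Write $\boldsymbol F:=\mathrm D_\Gamma\Phi:T\tau_0\to T\tau_r$ for its (constant) tangential differential, a linear isomorphism of the two tangent planes, and $J:=\mathrm ds_r/\mathrm ds_0$ for the constant surface Jacobian, so that $|\det\boldsymbol F|=J$ in orthonormal bases of $T\tau_0$ and $T\tau_r$. Orient $\boldsymbol n_r$ so that $\Phi$ preserves the induced orientation, i.e. $\det\boldsymbol F=J>0$ (in positively oriented orthonormal bases). Let $\mathcal P$ be the contravariant surface Piola transform, $(\mathcal P\boldsymbol u)\circ\Phi=J^{-1}\boldsymbol F\boldsymbol u$. Then $$\langle\mathcal P\boldsymbol u,\mathcal P\boldsymbol v\rangle_{\times,\tau_r}=\langle\boldsymbol u,\boldsymbol v\rangle_{\times,\tau_0}$$ for all tangential fields $\boldsymbol u,\boldsymbol v$ on $\tau_0$. Consequently, if the nominal and perturbed triangulations share their connectivity and correspond element by element under such (orientation-preserving, affine) maps, and if the Buffa–Christiansen coefficients are determined by that connectivity alone, then $$\boldsymbol N_{XY}(\Gamma_{\boldsymbol y})=\Pi_X^\top\,\boldsymbol N_{XY,0}\,\Pi_Y$$ identically, with no dependence on the vertex positions.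
   Context: For a flat triangle (or triangulated oriented surface) $\tau$ with unit normal $\boldsymbol n$ and square-integrable tangential fields $\boldsymbol u,\boldsymbol v$, the rotated pairing is $\langle\boldsymbol u,\boldsymbol v\rangle_{\times,\tau}=\int_\tau(\boldsymbol u\times\boldsymbol n)\cdot\boldsymbol v\,ds$. The nominal surface is a closed oriented triangulated surface made of flat triangles; the perturbed surface, denoted $\Gamma_{\boldsymbol y}$, is obtained by displacing the vertices and redrawing flat triangles with the same connectivity, no triangle degenerating. The elementwise affine maps send each nominal triangle to the corresponding perturbed triangle (vertex to corresponding vertex), hence also map the barycentric refinement of the first mesh to that of the second. RWG (Rao–Wilton–Glisson) functions: the lowest-order div-conforming (Raviart–Thomas) functions, one per edge of the mesh, supported on the two triangles sharing the edge, defined on each triangle as the contravariant Piola image of the fixed reference-triangle shape function (Jacobian normalization, no edge-length factor), with a sign orientation attached to the edge which is the same for corresponding edges. $X_h$ is the span of the RWG functions on the primal mesh. Buffa–Christiansen (BC) functions: one per edge of the primal mesh, each a fixed linear combination of RWG functions on the barycentric refinement, supported on the union of barycentric cells surrounding the two endpoints of the edge; $Y_h$ is their span. "Coefficients determined by the connectivity alone" means that corresponding BC functions on the two meshes have the same coefficients with respect to the corresponding barycentric RWG functions. $\boldsymbol N_{XY}$ is the matrix of the $X_h$–$Y_h$ duality pairing: its $(i,j)$ entry is the rotated pairing, over the surface, of the $i$-th RWG function with the $j$-th BC function; $\boldsymbol N_{XY,0}$ is that matrix on the nominal mesh and $\boldsymbol N_{XY}(\Gamma_{\boldsymbol y})$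 that on the perturbed mesh. $\Pi_X$ (resp. $\Pi_Y$) is the permutation matrix recording the relabelling of RWG (resp. BC) degrees of freedom: $(\Pi_X)_{ki}=1$ if the $i$-th perturbed RWG function is attached to the same (corresponding) primal edge as the $k$-th nominal one, and $0$ otherwise; likewise $\Pi_Y$. *)

theory Defs
  imports "HOL-Analysis.Analysis"
begin

unbundle cross3_syntax

text \<open>A triangle is an ordered triple of vertices. The same type is used for a geometric triangle
  (vertices in \<open>real^3\<close>) and for a triangle of an abstract mesh (vertices are labels). The ordering
  fixes the affine parametrisation over the reference triangle and an orientation.\<close>

type_synonym 'v tri = "'v \<times> 'v \<times> 'v"

definition map_tri :: "('v \<Rightarrow> 'w) \<Rightarrow> 'v tri \<Rightarrow> 'w tri" where
  "map_tri p = (\<lambda>(a, b, c). (p a, p b, p c))"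

definition tri_verts :: "'v tri \<Rightarrow> 'v set" where
  "tri_verts = (\<lambda>(a, b, c). {a, b, c})"

definition nondegenerate :: "(real^3) tri \<Rightarrow> bool" where
  "nondegenerate t \<longleftrightarrow> \<not> collinear (tri_verts t)"

definition flat_tri :: "(real^3) tri \<Rightarrow> (real^3) set" where
  "flat_tri t = convex hull (tri_verts t)"

definition is_unit_normal :: "(real^3) tri \<Rightarrow> real^3 \<Rightarrow> bool" where
  "is_unit_normal = (\<lambda>(a, b, c) n. norm n = 1 \<and> n \<bullet> (b - a) = 0 \<and> n \<bullet> (c - a) = 0)"

definition oriented_normal :: "(real^3) tri \<Rightarrow> real^3" where
  "oriented_normal = (\<lambda>(a, b, c). (1 / norm ((b - a) \<times> (c - a))) *\<^sub>R ((b - a) \<times> (c - a)))"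

definition ref_tri :: "(real^2) set" where
  "ref_tri = convex hull {0, axis 1 1, axis 2 1}"

definition ref_map :: "(real^3) tri \<Rightarrow> real^2 \<Rightarrow> real^3" where
  "ref_map = (\<lambda>(a, b, c) x. a + (x $ 1) *\<^sub>R (b - a) + (x $ 2) *\<^sub>R (c - a))"

definition ref_diff :: "(real^3) tri \<Rightarrow> real^2 \<Rightarrow> real^3" where
  "ref_diff = (\<lambda>(a, b, c) x. (x $ 1) *\<^sub>R (b - a) + (x $ 2) *\<^sub>R (c - a))"

definition area_element :: "(real^3) tri \<Rightarrow> real" where
  "area_element = (\<lambda>(a, b, c). norm ((b - a) \<times> (c - a)))"

text \<open>Surface measure \<open>ds\<close> on a flat triangle, through the parametrisation \<open>ref_map\<close> and its area
  element. It is a measure on the space \<open>flat_tri t\<close> and does not depend on the vertex ordering.\<close>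

definition surface_measure :: "(real^3) tri \<Rightarrow> (real^3) measure" where
  "surface_measure t =
     distr (scale_measure (ennreal (area_element t)) (restrict_space lborel ref_tri))
           (restrict_space borel (flat_tri t)) (ref_map t)"

definition rot_pairing ::
    "(real^3) tri \<Rightarrow> real^3 \<Rightarrow> (real^3 \<Rightarrow> real^3) \<Rightarrow> (real^3 \<Rightarrow> real^3) \<Rightarrow> real" where
  "rot_pairing t n u v = (LINT x|surface_measure t. (u x \<times> n) \<bullet> v x)"

definition L2_tangential :: "(real^3) tri \<Rightarrow> real^3 \<Rightarrow> (real^3 \<Rightarrow> real^3) \<Rightarrow> bool" where
  "L2_tangential t n u \<longleftrightarrow>
     u \<in> borel_measurable (surface_measure t) \<and>
     (AE x in surface_measure t. u x \<bullet> n = 0) \<and>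
     integrable (surface_measure t) (\<lambda>x. (norm (u x))\<^sup>2)"

definition affine_bijection ::
    "('a::real_vector \<Rightarrow> 'b::real_vector) \<Rightarrow> 'a set \<Rightarrow> 'b set \<Rightarrow> bool" where
  "affine_bijection \<Phi> S S' \<longleftrightarrow>
     (\<exists>L d. linear L \<and> (\<forall>x\<in>S. \<Phi> x = L x + d)) \<and> bij_betw \<Phi> S S'"

text \<open>The derivative within a flat triangle determines \<open>F\<close> on the tangent plane only; off the
  tangent plane \<open>F\<close> is an arbitrary linear extension.\<close>

definition tangential_differential ::
    "(real^3 \<Rightarrow> real^3) \<Rightarrow> (real^3) set \<Rightarrow> (real^3 \<Rightarrow> real^3) \<Rightarrow> bool" where
  "tangential_differential \<Phi> S F \<longleftrightarrow> (\<forall>x\<in>S. (\<Phi> has_derivative F) (at x within S))"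

text \<open>\<open>J = ds\<^sub>r / ds\<^sub>0\<close>: the measure \<open>ds\<^sub>r\<close> is \<open>J\<close> times the image of \<open>ds\<^sub>0\<close> under \<open>\<Phi>\<close>.\<close>

definition surface_jacobian ::
    "(real^3 \<Rightarrow> real^3) \<Rightarrow> (real^3) tri \<Rightarrow> (real^3) tri \<Rightarrow> real \<Rightarrow> bool" where
  "surface_jacobian \<Phi> t0 tr J \<longleftrightarrow>
     surface_measure tr =
       scale_measure (ennreal J) (distr (surface_measure t0) (surface_measure tr) \<Phi>)"

definition tangent_plane :: "real^3 \<Rightarrow> (real^3) set" where
  "tangent_plane n = {x. x \<bullet> n = 0}"

definition tangent_onb :: "real^3 \<Rightarrow> real^3^2 \<Rightarrow> bool" where
  "tangent_onb n e \<longleftrightarrow>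
     (\<forall>i. e $ i \<in> tangent_plane n) \<and> (\<forall>i j. e $ i \<bullet> e $ j = (if i = j then 1 else 0))"

definition positive_onb :: "real^3 \<Rightarrow> real^3^2 \<Rightarrow> bool" where
  "positive_onb n e \<longleftrightarrow> tangent_onb n e \<and> (e $ 1) \<times> (e $ 2) = n"

definition det_in_bases :: "(real^3 \<Rightarrow> real^3) \<Rightarrow> real^3^2 \<Rightarrow> real^3^2 \<Rightarrow> real" where
  "det_in_bases F e f = det ((\<chi> i j. F (e $ j) \<bullet> f $ i) :: real^2^2)"

definition orientation_preserving :: "(real^3 \<Rightarrow> real^3) \<Rightarrow> real^3 \<Rightarrow> real^3 \<Rightarrow> bool" where
  "orientation_preserving F n0 nr \<longleftrightarrow>
     (\<forall>e f. positive_onb n0 e \<and> positive_onb nr f \<longrightarrow> det_in_bases F e f > 0)"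

text \<open>Contravariant Piola transform of a field on \<open>S\<close> along \<open>\<Phi>\<close> with differential \<open>F\<close> and
  Jacobian \<open>J\<close>. Only its values on \<open>\<Phi> ` S\<close> are meaningful.\<close>

definition piola ::
    "('a \<Rightarrow> 'b::real_vector) \<Rightarrow> real \<Rightarrow> ('a \<Rightarrow> 'b) \<Rightarrow> 'a set \<Rightarrow> ('a \<Rightarrow> 'a) \<Rightarrow> 'b \<Rightarrow> 'b" where
  "piola F J \<Phi> S u = (\<lambda>y. (1 / J) *\<^sub>R F (u (inv_into S \<Phi> y)))"

definition tri_dedges :: "'v tri \<Rightarrow> ('v \<times> 'v) set" where
  "tri_dedges = (\<lambda>(a, b, c). {(a, b), (b, c), (c, a)})"

definition edges :: "'v tri set \<Rightarrow> 'v set set" where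
  "edges K = {{a, b} | a b. \<exists>T\<in>K. (a, b) \<in> tri_dedges T}"

text \<open>Each edge lies in exactly two triangles, which traverse it in opposite directions, and the
  triangles around each vertex form a single cycle.\<close>

definition closed_oriented_surface :: "'v tri set \<Rightarrow> bool" where
  "closed_oriented_surface K \<longleftrightarrow>
     finite K \<and> K \<noteq> {} \<and>
     (\<forall>T\<in>K. card (tri_verts T) = 3) \<and> inj_on tri_verts K \<and>
     (\<forall>T\<in>K. \<forall>(a, b)\<in>tri_dedges T.
        (\<exists>!T'. T' \<in> K \<and> (a, b) \<in> tri_dedges T') \<and>
        (\<exists>!T'. T' \<in> K \<and> (b, a) \<in> tri_dedges T')) \<and>
     (\<forall>v S. S \<subseteq> {T \<in> K. v \<in> tri_verts T} \<and> S \<noteq> {} \<and>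
        (\<forall>T\<in>S. \<forall>T'\<in>K. (\<exists>w. w \<noteq> v \<and> {v, w} \<subseteq> tri_verts T \<inter> tri_verts T') \<longrightarrow> T' \<in> S)
        \<longrightarrow> S = {T \<in> K. v \<in> tri_verts T})"

definition embedded :: "'v tri set \<Rightarrow> ('v \<Rightarrow> real^3) \<Rightarrow> bool" where
  "embedded K p \<longleftrightarrow>
     (\<forall>T\<in>K. \<forall>T'\<in>K. flat_tri (map_tri p T) \<inter> flat_tri (map_tri p T') =
        convex hull (p ` (tri_verts T \<inter> tri_verts T')))"

text \<open>Fields on a triangulated surface are given triangle by triangle: \<open>u T x\<close> is the value at
  the point \<open>x\<close> of the triangle \<open>T\<close>.\<close>

definition surface_pairing ::
    "'v tri set \<Rightarrow> ('v \<Rightarrow> real^3) \<Rightarrow>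
     ('v tri \<Rightarrow> real^3 \<Rightarrow> real^3) \<Rightarrow> ('v tri \<Rightarrow> real^3 \<Rightarrow> real^3) \<Rightarrow> real" where
  "surface_pairing K p u v =
     (\<Sum>T\<in>K. rot_pairing (map_tri p T) (oriented_normal (map_tri p T)) (u T) (v T))"

text \<open>The vertices of the barycentric refinement are the simplices of the mesh, realised by their
  barycentres. Each triangle is cut into six, with the inherited orientation.\<close>

definition bary_tri :: "'v tri \<Rightarrow> 'v set tri set" where
  "bary_tri = (\<lambda>(a, b, c).
     {({a}, {a, b}, {a, b, c}), ({a, b}, {b}, {a, b, c}),
      ({b}, {b, c}, {a, b, c}), ({b, c}, {c}, {a, b, c}),
      ({c}, {c, a}, {a, b, c}), ({c, a}, {a}, {a, b, c})})"

definition bary_refinement :: "'v tri set \<Rightarrow> 'v set tri set" where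
  "bary_refinement K = (\<Union>T\<in>K. bary_tri T)"

definition bary_pos :: "('v \<Rightarrow> real^3) \<Rightarrow> 'v set \<Rightarrow> real^3" where
  "bary_pos p s = (1 / real (card s)) *\<^sub>R (\<Sum>v\<in>s. p v)"

text \<open>The part inside the triangle \<open>T\<close> of the barycentric cell surrounding the vertex \<open>v\<close>.\<close>

definition bary_cell :: "('v \<Rightarrow> real^3) \<Rightarrow> 'v tri \<Rightarrow> 'v \<Rightarrow> (real^3) set" where
  "bary_cell p T v =
     (\<Union>t\<in>{t \<in> bary_tri T. {v} \<in> tri_verts t}. flat_tri (map_tri (bary_pos p) t))"

definition opp_ref_vertex :: "'v tri \<Rightarrow> 'v set \<Rightarrow> real^2" where
  "opp_ref_vertex = (\<lambda>(a, b, c) e.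
     if e = {b, c} then 0 else if e = {c, a} then axis 1 1 else axis 2 1)"

text \<open>An orientation of the edges assigns to each edge one of its two directions. The sign is \<open>1\<close>
  on the triangle whose boundary traverses the edge in that direction, \<open>-1\<close> on the other triangle
  sharing the edge, and \<open>0\<close> off these two triangles.\<close>

definition edge_sign :: "('v \<times> 'v) \<Rightarrow> 'v tri \<Rightarrow> real" where
  "edge_sign = (\<lambda>(a, b) T.
     if (a, b) \<in> tri_dedges T then 1 else if (b, a) \<in> tri_dedges T then -1 else 0)"

definition edge_orientation :: "'v tri set \<Rightarrow> ('v set \<Rightarrow> 'v \<times> 'v) \<Rightarrow> bool" where
  "edge_orientation K ori \<longleftrightarrow> (\<forall>e\<in>edges K. {fst (ori e), snd (ori e)} = e)"

text \<open>The reference shape function of an edge is \<open>z - z\<^sub>0\<close>, with \<open>z\<^sub>0\<close> the opposite reference vertex;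
  it has unit flux through the edge and no normal component on the other two.\<close>

definition rwg ::
    "('v \<Rightarrow> real^3) \<Rightarrow> ('v set \<Rightarrow> 'v \<times> 'v) \<Rightarrow> 'v set \<Rightarrow> 'v tri \<Rightarrow> real^3 \<Rightarrow> real^3" where
  "rwg p ori e T x =
     edge_sign (ori e) T *\<^sub>R
       piola (ref_diff (map_tri p T)) (area_element (map_tri p T)) (ref_map (map_tri p T)) ref_tri
         (\<lambda>z. z - opp_ref_vertex T e) x"

text \<open>An RWG function of the barycentric refinement as a field on the original triangles. It is set
  to \<open>0\<close> on the interfaces between the six subtriangles, a null set.\<close>

definition bary_rwg ::
    "('v \<Rightarrow> real^3) \<Rightarrow> ('v set set \<Rightarrow> 'v set \<times> 'v set) \<Rightarrow> 'v set set \<Rightarrow>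
     'v tri \<Rightarrow> real^3 \<Rightarrow> real^3" where
  "bary_rwg p bori f T x =
     (\<Sum>t\<in>bary_tri T. if x \<in> rel_interior (flat_tri (map_tri (bary_pos p) t))
                     then rwg (bary_pos p) bori f t x else 0)"

text \<open>\<open>C e f\<close> is the coefficient of the Buffa-Christiansen function of the edge \<open>e\<close> with respect to
  the RWG function of the barycentric edge \<open>f\<close>.\<close>

definition bc ::
    "'v tri set \<Rightarrow> ('v \<Rightarrow> real^3) \<Rightarrow> ('v set set \<Rightarrow> 'v set \<times> 'v set) \<Rightarrow>
     ('v set \<Rightarrow> 'v set set \<Rightarrow> real) \<Rightarrow> 'v set \<Rightarrow> 'v tri \<Rightarrow> real^3 \<Rightarrow> real^3" where
  "bc K p bori C e T x = (\<Sum>f\<in>edges (bary_refinement K). C e f *\<^sub>R bary_rwg p bori f T x)"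

definition bc_supported ::
    "'v tri set \<Rightarrow> ('v \<Rightarrow> real^3) \<Rightarrow> ('v set set \<Rightarrow> 'v set \<times> 'v set) \<Rightarrow>
     ('v set \<Rightarrow> 'v set set \<Rightarrow> real) \<Rightarrow> bool" where
  "bc_supported K p bori C \<longleftrightarrow>
     (\<forall>e\<in>edges K. \<forall>T\<in>K.
        {x \<in> flat_tri (map_tri p T). bc K p bori C e T x \<noteq> 0} \<subseteq> (\<Union>v\<in>e. bary_cell p T v))"

text \<open>The finite index types \<open>'i\<close> and \<open>'j\<close> number the RWG and the BC functions; \<open>rwg_edge\<close> and
  \<open>bc_edge\<close> give the edge to which a numbered function is attached.\<close>

record ('v, 'i, 'j) discretised_surface =
  tris :: "'v tri set"
  pos :: "'v \<Rightarrow> real^3"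
  ori :: "'v set \<Rightarrow> 'v \<times> 'v"
  bary_ori :: "'v set set \<Rightarrow> 'v set \<times> 'v set"
  bc_coeff :: "'v set \<Rightarrow> 'v set set \<Rightarrow> real"
  rwg_edge :: "'i \<Rightarrow> 'v set"
  bc_edge :: "'j \<Rightarrow> 'v set"

definition valid_discretisation :: "('v, 'i::finite, 'j::finite) discretised_surface \<Rightarrow> bool" where
  "valid_discretisation M \<longleftrightarrow>
     closed_oriented_surface (tris M) \<and>
     (\<forall>T\<in>tris M. nondegenerate (map_tri (pos M) T)) \<and>
     edge_orientation (tris M) (ori M) \<and>
     edge_orientation (bary_refinement (tris M)) (bary_ori M) \<and>
     bc_supported (tris M) (pos M) (bary_ori M) (bc_coeff M) \<and>
     bij_betw (rwg_edge M) UNIV (edges (tris M)) \<and>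
     bij_betw (bc_edge M) UNIV (edges (tris M))"

definition N_XY :: "('v, 'i::finite, 'j::finite) discretised_surface \<Rightarrow> real^'j^'i" where
  "N_XY M = (\<chi> i j. surface_pairing (tris M) (pos M)
      (rwg (pos M) (ori M) (rwg_edge M i))
      (bc (tris M) (pos M) (bary_ori M) (bc_coeff M) (bc_edge M j)))"

definition same_connectivity ::
    "('v, 'i, 'j) discretised_surface \<Rightarrow> ('v, 'i, 'j) discretised_surface \<Rightarrow> bool" where
  "same_connectivity M0 Mr \<longleftrightarrow> tris Mr = tris M0"

definition same_edge_orientations ::
    "('v, 'i, 'j) discretised_surface \<Rightarrow> ('v, 'i, 'j) discretised_surface \<Rightarrow> bool" where
  "same_edge_orientations M0 Mr \<longleftrightarrow>
     (\<forall>e\<in>edges (tris M0). ori Mr e = ori M0 e) \<and>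
     (\<forall>f\<in>edges (bary_refinement (tris M0)). bary_ori Mr f = bary_ori M0 f)"

definition elementwise_affine ::
    "('v, 'i, 'j) discretised_surface \<Rightarrow> ('v, 'i, 'j) discretised_surface \<Rightarrow> bool" where
  "elementwise_affine M0 Mr \<longleftrightarrow>
     (\<forall>T\<in>tris M0. \<exists>\<Phi> F.
        affine_bijection \<Phi> (flat_tri (map_tri (pos M0) T)) (flat_tri (map_tri (pos Mr) T)) \<and>
        (\<forall>v\<in>tri_verts T. \<Phi> (pos M0 v) = pos Mr v) \<and>
        tangential_differential \<Phi> (flat_tri (map_tri (pos M0) T)) F \<and>
        orientation_preserving F
          (oriented_normal (map_tri (pos M0) T)) (oriented_normal (map_tri (pos Mr) T)))"

definition bc_coeffs_from_connectivity ::
    "('v, 'i, 'j) discretised_surface \<Rightarrow> ('v, 'i, 'j) discretised_surface \<Rightarrow> bool" where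
  "bc_coeffs_from_connectivity M0 Mr \<longleftrightarrow>
     (\<forall>e\<in>edges (tris M0). \<forall>f\<in>edges (bary_refinement (tris M0)). bc_coeff Mr e f = bc_coeff M0 e f)"

definition relabelling :: "('k \<Rightarrow> 'v set) \<Rightarrow> ('k \<Rightarrow> 'v set) \<Rightarrow> real^'k^'k::finite" where
  "relabelling nominal_edge perturbed_edge =
     (\<chi> k i. if perturbed_edge i = nominal_edge k then 1 else 0)"

end

theory Submission
  imports Defs
begin

text \<open>Extend the tangential differential to a linear map \<open>L\<close> of space by sending the normal of the
  first triangle to the normal of the second. Then \<open>(L x \<times> n\<^sub>r) \<bullet> L y = det L * ((x \<times> n\<^sub>0) \<bullet> y)\<close>, as
  both sides are triple products, and \<open>\<bar>det L\<bar>\<close> is the ratio of the two areas. The two factors \<open>1 / J\<close>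
  of the Piola transform, the factor \<open>det L = J\<close> and the Jacobian of the change of variables cancel.

  On corresponding mesh triangles the same \<open>L\<close>, completed by a translation, maps vertices to
  vertices, hence barycentres to barycentres, and multiplies the areas of all subtriangles by the
  same factor. So RWG and BC functions are Piola images of their nominal counterparts, and the
  entries of the duality matrix agree edge by edge.\<close>

section \<open>Triple products and tangent planes\<close>

text \<open>A triple product is the determinant of its three vectors, so this is multiplicativity of
  \<open>det\<close>. In coordinates it is a polynomial identity in the matrix entries and the
  components.\<close>

lemma linear_triple_product:
  fixes L :: "real^3 \<Rightarrow> real^3"
  assumes "linear L"
  shows "(L x \<times> L y) \<bullet> L z = det (matrix L) * ((x \<times> y) \<bullet> z)"
proof -
  define a where "a i j = matrix L $ i $ j" for i j
  have "L w = matrix L *v w" for w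
    using assms by (simp add: matrix_works)
  then have *: "L w = (\<chi> i. a i 1 * w $ 1 + a i 2 * w $ 2 + a i 3 * w $ 3)" for w
    unfolding a_def
    by (simp add: vec_eq_iff matrix_vector_mult_def sum_3)
  show ?thesis
    unfolding * det_3 a_def[symmetric] inner_vec_def sum_3 cross_components vec_lambda_beta inner_real_def
    by algebra
qed

lemma cross_tangent:
  fixes n :: "real^3"
  assumes "norm n = 1" "x \<bullet> n = 0" "y \<bullet> n = 0"
  shows "x \<times> y = ((x \<times> y) \<bullet> n) *\<^sub>R n"
proof -
  \<comment> \<open>\<open>Lagrange\<close> is the expansion of the double cross product. Here it
    shows that \<open>x \<times> y\<close> is parallel to \<open>n\<close>; applied again to
    \<open>n \<times> ((x \<times> y) \<times> n)\<close> it yields the coefficient.\<close>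
  have "n \<times> (x \<times> y) = 0"
    using assms by (simp add: Lagrange inner_commute)
  then have "(x \<times> y) \<times> n = 0"
    by (metis cross_skew neg_0_equal_iff_equal)
  then have "n \<times> ((x \<times> y) \<times> n) = 0" by simp
  then show ?thesis
    using assms by (simp add: Lagrange inner_commute norm_eq_1)
qed

lemma norm_cross_tangent:
  fixes n :: "real^3"
  assumes "norm n = 1" "x \<bullet> n = 0" "y \<bullet> n = 0"
  shows "norm (x \<times> y) = \<bar>(x \<times> y) \<bullet> n\<bar>"
  by (subst cross_tangent[OF assms]) (simp add: assms(1))

text \<open>Cramer's rule cleared of its denominator, hence a polynomial identity in the
  components.\<close>

lemma cramer3:
  fixes p q n x :: "real^3"
  shows "((p \<times> q) \<bullet> n) *\<^sub>R x =
    ((x \<times> q) \<bullet> n) *\<^sub>R p + ((p \<times> x) \<bullet> n) *\<^sub>R q + ((p \<times> q) \<bullet> x) *\<^sub>R n"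
  by (simp add: vec_eq_iff forall_3 cross3_def inner_vec_def sum_3 algebra_simps)

text \<open>Cramer's rule loses its normal term: \<open>p \<times> q\<close> is a multiple of
  \<open>n\<close>, hence orthogonal to the tangent vector \<open>x\<close>.\<close>

lemma tangent_decomposition:
  fixes n p q x :: "real^3"
  assumes n: "norm n = 1" "p \<bullet> n = 0" "q \<bullet> n = 0" and D: "(p \<times> q) \<bullet> n \<noteq> 0" and x: "x \<bullet> n = 0"
  shows "x = ((x \<times> q) \<bullet> n / ((p \<times> q) \<bullet> n)) *\<^sub>R p + ((p \<times> x) \<bullet> n / ((p \<times> q) \<bullet> n)) *\<^sub>R q"
proof -
  have "(p \<times> q) \<bullet> x = 0"
    using cross_tangent[OF n] x by (metis inner_commute inner_scaleR_right mult_zero_right)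
  then have eq: "((p \<times> q) \<bullet> n) *\<^sub>R x = ((x \<times> q) \<bullet> n) *\<^sub>R p + ((p \<times> x) \<bullet> n) *\<^sub>R q"
    using cramer3[of p q n x] by simp
  have "x = (1 / ((p \<times> q) \<bullet> n)) *\<^sub>R (((p \<times> q) \<bullet> n) *\<^sub>R x)"
    using D by simp
  then show ?thesis
    unfolding eq by (simp add: scaleR_add_right)
qed

text \<open>Sending \<open>n\<close> to \<open>n'\<close> makes the surface determinant of a tangential map the ordinary
  determinant of a linear map of space; \<open>L\<close> is Cramer's rule in the basis \<open>p, q, n\<close>.\<close>

lemma linear_tangent_extension:
  fixes n n' p q p' q' :: "real^3"
  assumes n: "norm n = 1" "p \<bullet> n = 0" "q \<bullet> n = 0" and D: "(p \<times> q) \<bullet> n \<noteq> 0"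
    and n': "norm n' = 1" "p' \<bullet> n' = 0" "q' \<bullet> n' = 0"
  obtains L where "linear L" "L p = p'" "L q = q'" "L n = n'" "\<And>x. L x \<bullet> n' = x \<bullet> n"
    "det (matrix L) * ((p \<times> q) \<bullet> n) = (p' \<times> q') \<bullet> n'"
proof -
  define L where "L x = ((x \<times> q) \<bullet> n / ((p \<times> q) \<bullet> n)) *\<^sub>R p' + ((p \<times> x) \<bullet> n / ((p \<times> q) \<bullet> n)) *\<^sub>R q'
    + (x \<bullet> n) *\<^sub>R n'" for x
  have lin: "linear L"
    by (rule linearI) (simp_all add: L_def cross_add_left cross_add_right cross_mult_left cross_mult_right
        inner_add_left add_divide_distrib scaleR_add_left scaleR_add_right)
  have L: "L p = p'" "L q = q'" "L n = n'"
    using n D by (simp_all add: L_def dot_cross_self norm_eq_1)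
  have "L x \<bullet> n' = x \<bullet> n" for x
    using n' by (simp add: L_def inner_add_left norm_eq_1)
  moreover have "det (matrix L) * ((p \<times> q) \<bullet> n) = (p' \<times> q') \<bullet> n'"
    using linear_triple_product[OF lin, of p q n] L by simp
  ultimately show ?thesis by (rule that[OF lin L])
qed

text \<open>Up to sign, the triple product with the unit normal measures area in the tangent plane.
  Since \<open>L\<close> preserves the normal and the normal component, its determinant is the area
  factor on that plane.\<close>

lemma norm_cross_linear:
  fixes L :: "real^3 \<Rightarrow> real^3"
  assumes "linear L" "L n = n'" "\<And>x. L x \<bullet> n' = x \<bullet> n" "norm n = 1" "norm n' = 1"
    and "x \<bullet> n = 0" "y \<bullet> n = 0"
  shows "norm (L x \<times> L y) = \<bar>det (matrix L)\<bar> * norm (x \<times> y)"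
  using linear_triple_product[OF assms(1), of x y n] assms
  by (simp add: norm_cross_tangent[of n' "L x" "L y"] norm_cross_tangent[of n x y] abs_mult)

text \<open>Writing \<open>n'\<close> as \<open>L n\<close> turns the rotated integrand into a
  triple product of three images under \<open>L\<close>.\<close>

lemma rot_triple_linear:
  fixes L :: "real^3 \<Rightarrow> real^3"
  assumes "linear L" "L n = n'"
  shows "(L x \<times> n') \<bullet> L y = det (matrix L) * ((x \<times> n) \<bullet> y)"
  using linear_triple_product[OF assms(1), of x n y] assms(2) by simp

section \<open>Surface integrals\<close>

lemma integral_scale_measure:
  fixes f :: "'a \<Rightarrow> real"
  assumes c: "0 \<le> c"
  shows "integral\<^sup>L (scale_measure (ennreal c) M) f = c * integral\<^sup>L M f"
proof (cases "f \<in> borel_measurable M")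
  case True
  have "scale_measure (ennreal c) M = density M (\<lambda>_. ennreal c)"
    by (rule measure_eqI) (simp_all add: emeasure_density_const)
  then show ?thesis
    using True c by (simp add: integral_density)
next
  case False
  \<comment> \<open>Scaling leaves the measurable sets unchanged, so \<open>f\<close> is integrable
    for neither measure and both integrals are the default \<open>0\<close>.\<close>
  then have "\<not> integrable M f" "\<not> integrable (scale_measure (ennreal c) M) f"
    by (auto dest!: borel_measurable_integrable
        simp: measurable_cong_sets[OF sets_scale_measure refl])
  then show ?thesis by (simp add: not_integrable_integral_eq)
qed

text \<open>Since \<open>f\<close> has a measurable inverse, \<open>g\<close> and \<open>g \<circ> f\<close> are simultaneously
  non-measurable, and both integrals then have the junk value \<open>0\<close>.\<close>

lemma integral_distr_isomorphism:
  fixes g :: "'b \<Rightarrow> real"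
  assumes f: "f \<in> measurable M N" and h: "h \<in> measurable N M"
    and inv: "\<And>y. y \<in> space N \<Longrightarrow> f (h y) = y"
  shows "integral\<^sup>L (distr M N f) g = (LINT x|M. g (f x))"
proof (cases "g \<in> borel_measurable N")
  case True
  with f show ?thesis by (rule integral_distr)
next
  case False
  have "\<not> (\<lambda>x. g (f x)) \<in> borel_measurable M"
  proof
    assume "(\<lambda>x. g (f x)) \<in> borel_measurable M"
    from measurable_compose[OF h this] have "(\<lambda>y. g (f (h y))) \<in> borel_measurable N" .
    with inv have "g \<in> borel_measurable N" by (simp cong: measurable_cong)
    with False show False ..
  qed
  then have "\<not> integrable M (\<lambda>x. g (f x))" "\<not> integrable (distr M N f) g"
    using False by (auto dest: borel_measurable_integrable)
  then show ?thesis by (simp add: not_integrable_integral_eq)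
qed

section \<open>Affine parametrisation of a flat triangle\<close>

lemma linear_ref_diff: "linear (ref_diff t)"
  by (cases t) (auto simp: ref_diff_def linear_iff algebra_simps)

lemma ref_map_eq: "ref_map t z = fst t + ref_diff t z"
  by (cases t) (simp add: ref_map_def ref_diff_def)

lemma flat_tri_eq_ref_map_image: "flat_tri t = ref_map t ` ref_tri"
proof -
  obtain a b c where t: "t = (a, b, c)" by (cases t)
  have e: "ref_diff t 0 = 0" "ref_diff t (axis 1 1) = b - a" "ref_diff t (axis 2 1) = c - a"
    by (simp_all add: t ref_diff_def axis_def)
  have "ref_map t ` ref_tri = (+) a ` ref_diff t ` ref_tri"
    by (simp add: image_image ref_map_eq t)
  also have "\<dots> = convex hull ((+) a ` ref_diff t ` {0, axis 1 1, axis 2 1})"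
    unfolding ref_tri_def
    by (simp only: convex_hull_linear_image[OF linear_ref_diff] convex_hull_translation)
  also have "(+) a ` ref_diff t ` {0, axis 1 1, axis 2 1} = {a, b, c}"
    by (simp only: image_insert image_empty e) simp
  finally show ?thesis by (simp add: flat_tri_def tri_verts_def t)
qed

lemma cross_ref_diff:
  "ref_diff (a, b, c) x \<times> ref_diff (a, b, c) y =
     (x $ 1 * y $ 2 - x $ 2 * y $ 1) *\<^sub>R ((b - a) \<times> (c - a))"
proof -
  \<comment> \<open>Naming the edge vectors keeps the differences from being expanded and lets
    \<open>q \<times> p\<close> be reduced to \<open>p \<times> q\<close>.\<close>
  have "c - a = q \<Longrightarrow> b - a = p \<Longrightarrow> ?thesis" for p q
    by (simp add: ref_diff_def cross_add_left cross_add_right cross_mult_left cross_mult_right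
        cross_skew[of q p] algebra_simps)
  then show ?thesis by blast
qed

lemma nondegenerate_iff: "nondegenerate (a, b, c) \<longleftrightarrow> (b - a) \<times> (c - a) \<noteq> 0"
proof -
  \<comment> \<open>\<open>collinear_3\<close> takes its middle point as base point, so
    \<open>a\<close> is moved there.\<close>
  have "collinear {a, b, c} \<longleftrightarrow> collinear {b, a, c}" by (simp add: insert_commute)
  then show ?thesis
  by (simp add: nondegenerate_def tri_verts_def cross_eq_0 collinear_3[of b a c])
qed

lemma area_element_pos: "nondegenerate t \<Longrightarrow> area_element t > 0"
  by (cases t) (simp add: nondegenerate_iff area_element_def)

lemma inj_ref_diff:
  assumes "nondegenerate t"
  shows "inj (ref_diff t)"
proof -
  obtain a b c where t: "t = (a, b, c)" by (cases t)
  have nz: "(b - a) \<times> (c - a) \<noteq> 0" using assms by (simp add: t nondegenerate_iff)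
  have "z = 0" if z: "ref_diff t z = 0" for z
  proof -
    \<comment> \<open>The product with the second edge isolates \<open>z $ 1\<close>, the product
      with the first isolates \<open>z $ 2\<close> up to sign.\<close>
    have "ref_diff t z \<times> ref_diff t (axis 2 1) = 0" "ref_diff t z \<times> ref_diff t (axis 1 1) = 0"
      using z by simp_all
    then have "z $ 1 = 0" "z $ 2 = 0"
      using nz by (simp_all add: t cross_ref_diff axis_def)
    then show ?thesis by (simp add: vec_eq_iff forall_2)
  qed
  then show ?thesis by (simp add: linear_injective_0[OF linear_ref_diff])
qed

lemma inj_ref_map: "nondegenerate t \<Longrightarrow> inj (ref_map t)"
  using inj_ref_diff[of t] by (auto simp: inj_def ref_map_eq)

lemma compact_ref_tri: "compact ref_tri"
  unfolding ref_tri_def by (intro finite_imp_compact_convex_hull) simp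

lemma measure_ref_tri_pos: "0 < measure lebesgue ref_tri"
proof -
  \<comment> \<open>\<open>ref_tri\<close> is the standard simplex of the plane, whose area is known
    to be \<open>1 / fact 2\<close>.\<close>
  have "convex hull insert 0 Basis = (ref_tri :: (real^2) set)"
    by (simp add: ref_tri_def Basis_vec_def UNIV_2 insert_commute)
  then have "measure lborel ref_tri = 1 / fact 2"
    using content_std_simplex[where 'a = "real^2"] by simp
  then show ?thesis
    using compact_ref_tri by (simp add: borel_compact)
qed

lemma is_unit_normal_ref_diff:
  assumes "is_unit_normal t n"
  shows "ref_diff t z \<bullet> n = 0"
  using assms by (cases t) (simp add: is_unit_normal_def ref_diff_def inner_add_left inner_commute[of _ n] inner_add_right)

lemma tangent_in_range_ref_diff:
  assumes "nondegenerate t" "is_unit_normal t n" "x \<bullet> n = 0"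
  shows "x \<in> range (ref_diff t)"
proof -
  obtain a b c where t: "t = (a, b, c)" by (cases t)
  have n: "norm n = 1" "(b - a) \<bullet> n = 0" "(c - a) \<bullet> n = 0"
    using assms(2) by (simp_all add: t is_unit_normal_def inner_commute)
  have "((b - a) \<times> (c - a)) \<bullet> n \<noteq> 0"
    using norm_cross_tangent[OF n] assms(1) by (auto simp: t nondegenerate_iff)
  from tangent_decomposition[OF n this assms(3)] obtain \<alpha> \<beta>
    where "x = \<alpha> *\<^sub>R (b - a) + \<beta> *\<^sub>R (c - a)" by blast
  then have "x = ref_diff t (vector [\<alpha>, \<beta>])"
    by (simp add: t ref_diff_def)
  then show ?thesis by blast
qed

lemma space_surface_measure: "space (surface_measure t) = flat_tri t"
  by (simp add: surface_measure_def space_restrict_space)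

lemma sets_surface_measure [measurable_cong]:
  "sets (surface_measure t) = sets (restrict_space borel (flat_tri t))"
  by (simp add: surface_measure_def)

lemma measurable_restrict_borel:
  fixes f :: "'a::topological_space \<Rightarrow> 'b::topological_space"
  assumes "continuous_on UNIV f" "f ` S \<subseteq> T"
  shows "f \<in> restrict_space borel S \<rightarrow>\<^sub>M restrict_space borel T"
  using assms
  by (intro measurable_restrict_space3 borel_measurable_continuous_onI) auto

lemma continuous_on_ref_map: "continuous_on UNIV (ref_map t)"
  unfolding ref_map_eq
  by (intro continuous_intros linear_continuous_on linear_ref_diff[THEN linear_conv_bounded_linear[THEN iffD1]])

lemma measurable_ref_map:
  "ref_map t \<in> restrict_space lborel ref_tri \<rightarrow>\<^sub>M restrict_space borel (flat_tri t)"
  using measurable_restrict_borel[OF continuous_on_ref_map flat_tri_eq_ref_map_image[symmetric, THEN equalityD1]]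
  by (simp cong: measurable_cong_sets[OF sets_restrict_space_cong[OF sets_lborel] refl])

text \<open>The parametrisation has an affine, hence measurable, inverse. The formula thus covers
  every \<open>g\<close>, and the RWG and BC fields can be integrated without first proving them
  measurable.\<close>

lemma integral_surface_measure:
  fixes g :: "real^3 \<Rightarrow> real"
  assumes t: "nondegenerate t"
  shows "integral\<^sup>L (surface_measure t) g =
    area_element t * (LINT z|restrict_space lborel ref_tri. g (ref_map t z))"
proof -
  obtain k where k: "linear k" "k \<circ> ref_diff t = id"
    using linear_injective_left_inverse[OF linear_ref_diff inj_ref_diff[OF t]] by blast
  have inv: "k (ref_map t z - fst t) = z" for z
    using k(2) by (simp add: ref_map_eq fun_eq_iff)
  have "continuous_on UNIV (\<lambda>y. k (y - fst t))"
    by (intro continuous_intros linear_continuous_on_compose[OF _ k(1)])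
  then have "(\<lambda>y. k (y - fst t)) \<in> restrict_space borel (flat_tri t) \<rightarrow>\<^sub>M restrict_space borel ref_tri"
    by (rule measurable_restrict_borel) (auto simp: flat_tri_eq_ref_map_image inv)
  then have h: "(\<lambda>y. k (y - fst t)) \<in> restrict_space borel (flat_tri t) \<rightarrow>\<^sub>M
      scale_measure (ennreal (area_element t)) (restrict_space lborel ref_tri)"
    by (simp cong: measurable_cong_sets[OF refl sets_restrict_space_cong[OF sets_lborel]])
  have "integral\<^sup>L (surface_measure t) g =
      (LINT z|scale_measure (ennreal (area_element t)) (restrict_space lborel ref_tri). g (ref_map t z))"
    unfolding surface_measure_def
  proof (rule integral_distr_isomorphism[OF _ h])
    show "ref_map t \<in> scale_measure (ennreal (area_element t)) (restrict_space lborel ref_tri)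
        \<rightarrow>\<^sub>M restrict_space borel (flat_tri t)"
      using measurable_ref_map by (simp cong: measurable_cong_sets)
  qed (auto simp: space_restrict_space flat_tri_eq_ref_map_image inv)
  then show ?thesis
    using area_element_pos[OF t] by (simp add: integral_scale_measure)
qed

lemma emeasure_surface_measure_flat_tri:
  assumes t: "nondegenerate t"
  shows "emeasure (surface_measure t) (flat_tri t) =
    ennreal (area_element t * measure lebesgue ref_tri)"
proof -
  have c: "ref_tri \<in> sets lborel" "emeasure lborel ref_tri \<noteq> \<infinity>"
    using compact_ref_tri emeasure_bounded_finite[OF compact_imp_bounded[OF compact_ref_tri]]
    by (auto simp: borel_compact)
  have "emeasure (surface_measure t) (flat_tri t) =
    emeasure (scale_measure (ennreal (area_element t)) (restrict_space lborel ref_tri))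
      (ref_map t -` flat_tri t \<inter> ref_tri)"
    unfolding surface_measure_def using measurable_ref_map[of t]
    by (subst emeasure_distr)
      (auto simp: space_scale_measure space_restrict_space sets_restrict_space cong: measurable_cong_sets
        intro!: image_eqI[of _ _ "UNIV"])
  also have "ref_map t -` flat_tri t \<inter> ref_tri = ref_tri"
    by (auto simp: flat_tri_eq_ref_map_image)
  also have "emeasure (scale_measure (ennreal (area_element t)) (restrict_space lborel ref_tri)) ref_tri
      = ennreal (area_element t) * emeasure lborel ref_tri"
    using c by (simp add: emeasure_restrict_space)
  also have "emeasure lborel ref_tri = ennreal (measure lebesgue ref_tri)"
    using c by (simp add: emeasure_eq_ennreal_measure)
  finally show ?thesis
    using area_element_pos[OF t] by (simp add: ennreal_mult)
qed

text \<open>A set such as a flat triangle has empty interior in space, so its derivatives within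
  \<open>S\<close> are not unique. Along the segment from \<open>a\<close> to \<open>b\<close> the
  problem becomes one-dimensional, and there the derivative is unique, even at the endpoint
  \<open>0\<close>.\<close>

lemma has_derivative_affine_on_segment:
  fixes \<Phi> :: "'a::real_normed_vector \<Rightarrow> 'b::real_normed_vector"
  assumes F: "(\<Phi> has_derivative F) (at a within S)" and S: "convex S" "a \<in> S" "b \<in> S"
    and L: "linear L" "\<And>x. x \<in> S \<Longrightarrow> \<Phi> x = L x + d"
  shows "F (b - a) = L (b - a)"
proof -
  define \<gamma> where "\<gamma> s = a + s *\<^sub>R (b - a)" for s :: real
  have \<gamma>: "\<gamma> s \<in> S" if "s \<in> {0..1}" for s
    using convexD_alt[OF S, of s] that by (simp add: \<gamma>_def algebra_simps)
  have "(\<gamma> has_vector_derivative (b - a)) (at 0 within {0..1})"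
    unfolding \<gamma>_def by (auto intro!: derivative_eq_intros)
  moreover have "(\<Phi> has_derivative F) (at (\<gamma> 0) within \<gamma> ` {0..1})"
    using F \<gamma> by (auto simp: \<gamma>_def intro: has_derivative_subset)
  ultimately have "((\<Phi> \<circ> \<gamma>) has_vector_derivative F (b - a)) (at 0 within {0..1})"
    by (rule vector_derivative_diff_chain_within)
  moreover have "((\<Phi> \<circ> \<gamma>) has_vector_derivative L (b - a)) (at 0 within {0..1})"
  proof (rule has_vector_derivative_transform)
    show "((\<lambda>s. (L a + d) + s *\<^sub>R L (b - a)) has_vector_derivative L (b - a)) (at 0 within {0..1})"
      by (auto intro!: derivative_eq_intros)
    show "(\<Phi> \<circ> \<gamma>) s = (L a + d) + s *\<^sub>R L (b - a)" if "s \<in> {0..1}" for s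
      using L(2)[OF \<gamma>[OF that]] by (simp add: \<gamma>_def linear_add[OF L(1)] linear_scale[OF L(1)])
  qed auto
  ultimately show ?thesis
    using vector_derivative_unique_within_closed_interval[of 0 1 0] by simp
qed

section \<open>Invariance of the rotated pairing\<close>

lemma det_matrix_2:
  fixes G :: "real^2 \<Rightarrow> real^2"
  shows "det (matrix G) =
    G (axis 1 1) $ 1 * G (axis 2 1) $ 2 - G (axis 1 1) $ 2 * G (axis 2 1) $ 1"
  by (simp add: det_2 matrix_def mult.commute)

lemma norm_cross_ref_diff:
  "norm (ref_diff t x \<times> ref_diff t y) = \<bar>x $ 1 * y $ 2 - x $ 2 * y $ 1\<bar> * area_element t"
  by (cases t) (simp add: cross_ref_diff area_element_def)

lemma det_affine_self_map_ref_tri: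
  fixes G :: "real^2 \<Rightarrow> real^2"
  assumes G: "linear G" and im: "(\<lambda>z. G z + w) ` ref_tri = ref_tri"
  shows "\<bar>det (matrix G)\<bar> = 1"
proof -
  have "measure lebesgue ref_tri = measure lebesgue ((+) w ` G ` ref_tri)"
    using im by (simp add: image_image add.commute)
  also have "\<dots> = \<bar>det (matrix G)\<bar> * measure lebesgue ref_tri"
    using G compact_ref_tri
    by (simp add: measure_translation measure_linear_image lmeasurable_compact)
  finally show ?thesis
    using measure_ref_tri_pos by simp
qed

text \<open>The surface Jacobian is computed without matching vertices: pulled back to the reference
  triangle, \<open>\<Phi>\<close> becomes an affine self-map of \<open>ref_tri\<close>, whose determinant is \<open>\<plusminus>1\<close> because it
  preserves the positive finite area.\<close>

lemma affine_bijection_flat_tri: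
  assumes t0: "nondegenerate t0" "is_unit_normal t0 n0" and tr: "nondegenerate tr" "is_unit_normal tr nr"
    and \<Phi>: "affine_bijection \<Phi> (flat_tri t0) (flat_tri tr)"
    and F: "tangential_differential \<Phi> (flat_tri t0) F"
  obtains L d where "linear L" "L n0 = nr" "\<And>x. L x \<bullet> nr = x \<bullet> n0"
    "\<And>x. x \<in> flat_tri t0 \<Longrightarrow> \<Phi> x = L x + d" "\<And>x. x \<bullet> n0 = 0 \<Longrightarrow> F x = L x"
    "\<bar>det (matrix L)\<bar> * area_element t0 = area_element tr"
proof -
  obtain a b c where t: "t0 = (a, b, c)" by (cases t0)
  obtain L0 d0 where L0: "linear L0" "\<And>x. x \<in> flat_tri t0 \<Longrightarrow> \<Phi> x = L0 x + d0"
    and bij: "bij_betw \<Phi> (flat_tri t0) (flat_tri tr)"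
    using \<Phi> by (auto simp: affine_bijection_def)
  have verts: "a \<in> flat_tri t0" "b \<in> flat_tri t0" "c \<in> flat_tri t0"
    by (auto simp: t flat_tri_def tri_verts_def intro: hull_inc)
  have der: "(\<Phi> has_derivative F) (at a within flat_tri t0)"
    using F verts by (simp add: tangential_differential_def)
  then have linF: "linear F" by (rule has_derivative_linear)
  have convex: "convex (flat_tri t0)" by (simp add: flat_tri_def)
  have F_eq: "F (v - a) = L0 (v - a)" "F (v - a) = \<Phi> v - \<Phi> a" if "v \<in> flat_tri t0" for v
    using has_derivative_affine_on_segment[OF der convex verts(1) that L0] L0 verts(1) that
    by (simp_all add: linear_diff)
  have tri: "(x - fst tr) \<bullet> nr = 0" if "x \<in> flat_tri tr" for x
    using that is_unit_normal_ref_diff[OF tr(2)] by (auto simp: flat_tri_eq_ref_map_image ref_map_eq)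
  \<comment> \<open>\<open>F (v - a)\<close> is a difference of two points of the target triangle,
    hence tangent to it.\<close>
  have F_tan: "F (v - a) \<bullet> nr = 0" if "v \<in> flat_tri t0" for v
  proof -
    have "\<Phi> v \<in> flat_tri tr" "\<Phi> a \<in> flat_tri tr"
      using bij that verts(1) by (auto simp: bij_betw_def)
    then have "(\<Phi> v - fst tr) \<bullet> nr - (\<Phi> a - fst tr) \<bullet> nr = 0"
      using tri by simp
    then show ?thesis
      using F_eq(2)[OF that] by (simp add: inner_diff_left)
  qed
  have n0: "norm n0 = 1" "(b - a) \<bullet> n0 = 0" "(c - a) \<bullet> n0 = 0"
    using t0(2) by (simp_all add: t is_unit_normal_def inner_commute)
  have nr: "norm nr = 1"
    using tr(2) by (cases tr) (simp add: is_unit_normal_def)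
  have nz: "((b - a) \<times> (c - a)) \<bullet> n0 \<noteq> 0"
    using norm_cross_tangent[OF n0] t0(1) by (auto simp: t nondegenerate_iff)
  \<comment> \<open>The given linear part \<open>L0\<close> is arbitrary in the normal direction.
    \<open>L\<close> keeps its values on the two edges and sends normal to normal.\<close>
  obtain L where L: "linear L" "L (b - a) = F (b - a)" "L (c - a) = F (c - a)" "L n0 = nr"
      "\<And>x. L x \<bullet> nr = x \<bullet> n0"
    using linear_tangent_extension[OF n0 nz nr F_tan F_tan] verts by metis
  have L_diff: "L (ref_diff t0 z) = F (ref_diff t0 z)" "L0 (ref_diff t0 z) = F (ref_diff t0 z)" for z
    using L(1-3) linF L0(1) F_eq(1)[OF verts(2)] F_eq(1)[OF verts(3)]
    by (simp_all add: t ref_diff_def linear_add linear_scale)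
  have \<Phi>_eq: "\<Phi> (ref_map t0 z) = \<Phi> a + L (ref_diff t0 z)" if "z \<in> ref_tri" for z
  proof -
    have "ref_map t0 z \<in> flat_tri t0" using that by (simp add: flat_tri_eq_ref_map_image)
    then show ?thesis
      using L0 verts(1) L_diff by (simp add: ref_map_eq t linear_add)
  qed
  have 1: "\<Phi> x = L x + (\<Phi> a - L a)" if x: "x \<in> flat_tri t0" for x
  proof -
    obtain z where "z \<in> ref_tri" "x = ref_map t0 z"
      using x by (auto simp: flat_tri_eq_ref_map_image)
    then show ?thesis
      using \<Phi>_eq L(1) by (simp add: ref_map_eq t linear_add)
  qed
  have 2: "F x = L x" if "x \<bullet> n0 = 0" for x
    using tangent_in_range_ref_diff[OF t0 that] L_diff(1) by auto
  have 3: "\<bar>det (matrix L)\<bar> * area_element t0 = area_element tr"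
  proof -
    obtain k where k: "linear k" "k \<circ> ref_diff tr = id"
      using linear_injective_left_inverse[OF linear_ref_diff inj_ref_diff[OF tr(1)]] by blast
    \<comment> \<open>\<open>G\<close> is the linear part of \<open>\<Phi>\<close> read in the two
      parametrisations; the translation \<open>w\<close> chosen below is the parameter of
      \<open>\<Phi> a\<close>.\<close>
    define G where "G = k \<circ> L \<circ> ref_diff t0"
    have G: "linear G"
      unfolding G_def by (intro linear_compose linear_ref_diff k L)
    have G_eq: "ref_diff tr (G z) = L (ref_diff t0 z)" for z
    proof -
      have "L (ref_diff t0 z) \<bullet> nr = 0"
        using L(5) is_unit_normal_ref_diff[OF t0(2)] by simp
      then obtain w where "L (ref_diff t0 z) = ref_diff tr w"
        using tangent_in_range_ref_diff[OF tr] by blast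
      then show ?thesis using k(2) by (simp add: G_def fun_eq_iff)
    qed
    have "\<Phi> a \<in> flat_tri tr" using bij verts(1) by (auto simp: bij_betw_def)
    then obtain w where w: "\<Phi> a = ref_map tr w" by (auto simp: flat_tri_eq_ref_map_image)
    have map_eq: "ref_map tr (G z + w) = \<Phi> (ref_map t0 z)" if "z \<in> ref_tri" for z
      using \<Phi>_eq[OF that] by (simp add: w ref_map_eq linear_add[OF linear_ref_diff] G_eq)
    have "ref_map tr ` (\<lambda>z. G z + w) ` ref_tri = \<Phi> ` flat_tri t0"
      unfolding flat_tri_eq_ref_map_image image_image using map_eq by (rule image_cong[OF refl])
    also have "\<dots> = ref_map tr ` ref_tri"
      using bij by (simp add: bij_betw_def flat_tri_eq_ref_map_image[of tr])
    finally have "(\<lambda>z. G z + w) ` ref_tri = ref_tri"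
      by (simp add: inj_image_eq_iff[OF inj_ref_map[OF tr(1)]])
    then have det: "\<bar>det (matrix G)\<bar> = 1"
      by (rule det_affine_self_map_ref_tri[OF G])
    \<comment> \<open>The area of the parallelogram spanned by the image edges is computed twice,
      through \<open>L\<close> and through \<open>G\<close>.\<close>
    have "\<bar>det (matrix L)\<bar> * area_element t0 = norm (L (b - a) \<times> L (c - a))"
      using norm_cross_linear[OF L(1,4,5) n0(1) nr n0(2,3)] by (simp add: t area_element_def)
    also have "\<dots> = norm (ref_diff tr (G (axis 1 1)) \<times> ref_diff tr (G (axis 2 1)))"
      by (simp add: G_eq) (simp add: t ref_diff_def axis_def)
    also have "\<dots> = \<bar>det (matrix G)\<bar> * area_element tr"
      by (simp add: norm_cross_ref_diff det_matrix_2)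
    finally show ?thesis by (simp add: det)
  qed
  show ?thesis by (rule that[OF L(1,4,5) 1 2 3])
qed

section \<open>Determinants in orthonormal tangent bases\<close>

lemma det_in_bases_eq_cross:
  "det_in_bases F e f = (F (e $ 1) \<times> F (e $ 2)) \<bullet> (f $ 1 \<times> f $ 2)"
  \<comment> \<open>\<open>dot_cross\<close> expands the inner product of two cross products as the
    2 by 2 determinant of mutual inner products.\<close>
  by (simp add: det_in_bases_def det_2 dot_cross mult.commute)

text \<open>The sign \<open>\<sigma>\<close> records the orientation of the basis relative to
  \<open>n\<close>.\<close>

lemma tangent_onb_cross:
  assumes "norm n = 1" "tangent_onb n e"
  obtains \<sigma> :: real where "\<bar>\<sigma>\<bar> = 1" "e $ 1 \<times> e $ 2 = \<sigma> *\<^sub>R n"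
proof -
  have e: "e $ i \<bullet> n = 0" "e $ i \<bullet> e $ j = (if i = j then 1 else 0)" for i j
    using assms(2) by (auto simp: tangent_onb_def tangent_plane_def)
  have "(norm (e $ 1 \<times> e $ 2))\<^sup>2 = 1"
    by (simp add: power2_norm_eq_inner dot_cross e)
  then have "\<bar>(e $ 1 \<times> e $ 2) \<bullet> n\<bar> = 1"
    using norm_cross_tangent[OF assms(1) e(1) e(1)] by (auto simp: power2_eq_1_iff)
  then show ?thesis
    using that cross_tangent[OF assms(1) e(1) e(1)] by blast
qed

lemma det_in_bases_linear:
  assumes "linear L" "L n0 = nr" and n: "norm n0 = 1" "norm nr = 1"
    and e: "e $ 1 \<times> e $ 2 = \<sigma> *\<^sub>R n0" and f: "f $ 1 \<times> f $ 2 = \<tau> *\<^sub>R nr"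
  shows "det_in_bases L e f = \<tau> * \<sigma> * det (matrix L)"
  using linear_triple_product[OF assms(1), of "e $ 1" "e $ 2" n0] n
  by (simp add: det_in_bases_eq_cross e f assms(2) norm_eq_1)

text \<open>\<open>orientation_preserving\<close> quantifies over positive bases, so one must be
  exhibited on each side before the sign of the determinant can be read off. Here an edge is
  normalised and completed by its rotation about \<open>n\<close>.\<close>

lemma positive_onb_exists:
  assumes "nondegenerate t" "is_unit_normal t n"
  obtains e where "positive_onb n e"
proof -
  have n: "norm n = 1" using assms(2) by (cases t) (simp add: is_unit_normal_def)
  define x where "x = ref_diff t (axis 1 1)"
  have "x \<noteq> 0"
    using inj_eq[OF inj_ref_diff[OF assms(1)], of "axis 1 1" 0] linear_0[OF linear_ref_diff, of t]
    by (simp add: x_def axis_eq_0_iff)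
  define e1 where "e1 = (1 / norm x) *\<^sub>R x"
  have e1: "e1 \<bullet> n = 0" "e1 \<bullet> e1 = 1"
    using \<open>x \<noteq> 0\<close> is_unit_normal_ref_diff[OF assms(2)]
    by (simp_all add: e1_def x_def power2_norm_eq_inner[symmetric] power2_eq_square)
  have "positive_onb n (vector [e1, n \<times> e1])"
    using e1 n
    by (auto simp: positive_onb_def tangent_onb_def tangent_plane_def forall_2 Lagrange
        dot_cross dot_cross_self norm_eq_1 inner_commute)
  then show ?thesis by (rule that)
qed

lemma bij_betw_tangent_plane:
  assumes L: "linear L" "det (matrix L) \<noteq> 0" and n: "\<And>x. L x \<bullet> nr = x \<bullet> n0"
    and F: "\<And>x. x \<bullet> n0 = 0 \<Longrightarrow> F x = L x"
  shows "bij_betw F (tangent_plane n0) (tangent_plane nr)"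
proof -
  have inj: "inj L" using L by (simp add: det_nz_iff_inj)
  then have "surj L" using L(1) by (simp add: linear_injective_imp_surjective)
  \<comment> \<open>\<open>L\<close> preserves the normal component, so the preimage of a tangent
    vector is again tangent.\<close>
  then have "L ` tangent_plane n0 = tangent_plane nr"
    by (auto simp: tangent_plane_def n image_iff) (metis n surjD)
  then have "bij_betw L (tangent_plane n0) (tangent_plane nr)"
    using inj by (auto simp: bij_betw_def intro: inj_on_subset)
  then show ?thesis
    by (rule bij_betw_cong[THEN iffD1, rotated]) (simp add: F tangent_plane_def)
qed

section \<open>The surface Jacobian and change of variables\<close>

lemma measurable_surface_measure:
  assumes "continuous_on UNIV f" "f ` flat_tri t \<subseteq> flat_tri t'"
  shows "f \<in> surface_measure t \<rightarrow>\<^sub>M surface_measure t'"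
  using measurable_restrict_borel[OF assms]
  by (subst measurable_cong_sets[OF sets_surface_measure sets_surface_measure])

lemma measurable_affine_bijection:
  assumes bij: "bij_betw \<Phi> (flat_tri t0) (flat_tri tr)"
    and L: "linear L" "\<And>x. x \<in> flat_tri t0 \<Longrightarrow> \<Phi> x = L x + d"
  shows "\<Phi> \<in> surface_measure t0 \<rightarrow>\<^sub>M surface_measure tr"
proof -
  have "continuous_on UNIV (\<lambda>x. L x + d)"
    by (intro continuous_intros linear_continuous_on_compose[OF _ L(1)])
  moreover have "(\<lambda>x. L x + d) ` flat_tri t0 \<subseteq> flat_tri tr"
    using bij L(2) by (force simp: bij_betw_def)
  ultimately have "(\<lambda>x. L x + d) \<in> surface_measure t0 \<rightarrow>\<^sub>M surface_measure tr"
    by (rule measurable_surface_measure)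
  then show ?thesis
    by (rule measurable_cong[THEN iffD2, rotated]) (simp add: space_surface_measure L(2))
qed

text \<open>Both sides of the defining equation of \<open>J\<close> are evaluated on the whole
  target triangle, and the positive area of \<open>ref_tri\<close> is cancelled.\<close>

lemma surface_jacobian_area:
  assumes t: "nondegenerate t0" "nondegenerate tr"
    and bij: "bij_betw \<Phi> (flat_tri t0) (flat_tri tr)"
    and L: "linear L" "\<And>x. x \<in> flat_tri t0 \<Longrightarrow> \<Phi> x = L x + d"
    and J: "surface_jacobian \<Phi> t0 tr J"
  shows "J * area_element t0 = area_element tr"
proof -
  let ?m = "measure lebesgue ref_tri"
  have pre: "\<Phi> -` flat_tri tr \<inter> flat_tri t0 = flat_tri t0"
    using bij by (auto simp: bij_betw_def)
  have "ennreal (area_element tr * ?m) =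
      emeasure (scale_measure (ennreal J) (distr (surface_measure t0) (surface_measure tr) \<Phi>)) (flat_tri tr)"
    using J emeasure_surface_measure_flat_tri[OF t(2)] by (simp add: surface_jacobian_def)
  also have "\<dots> = ennreal J * ennreal (area_element t0 * ?m)"
    using measurable_affine_bijection[OF bij L] sets.top[of "surface_measure tr"]
    by (simp add: emeasure_distr pre emeasure_surface_measure_flat_tri[OF t(1)] space_surface_measure)
  finally have eq: "ennreal (area_element tr * ?m) = ennreal J * ennreal (area_element t0 * ?m)" .
  have pos: "area_element t0 > 0" "area_element tr > 0"
    using t by (auto intro: area_element_pos)
  \<comment> \<open>\<open>ennreal\<close> sends negative reals to \<open>0\<close>, so
    \<open>J \<le> 0\<close> would give the target triangle zero area.\<close>
  have "J > 0"
  proof (rule ccontr)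
    assume "\<not> J > 0"
    then have "ennreal J = 0" by (simp add: ennreal_neg)
    with eq pos measure_ref_tri_pos show False by (simp add: mult_le_0_iff)
  qed
  with eq pos measure_ref_tri_pos have "area_element tr * ?m = J * area_element t0 * ?m"
    by (simp add: ennreal_mult[symmetric] mult.assoc)
  then show ?thesis using measure_ref_tri_pos by simp
qed

text \<open>As \<open>y \<mapsto> k (y - d)\<close> is a measurable inverse of
  \<open>\<Phi>\<close>, arbitrary \<open>g\<close> are covered, in particular integrands built from
  Piola fields, which are defined through \<open>inv_into\<close>.\<close>

lemma integral_surface_jacobian:
  fixes g :: "real^3 \<Rightarrow> real"
  assumes bij: "bij_betw \<Phi> (flat_tri t0) (flat_tri tr)"
    and L: "linear L" "inj L" "\<And>x. x \<in> flat_tri t0 \<Longrightarrow> \<Phi> x = L x + d"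
    and J: "surface_jacobian \<Phi> t0 tr J" "0 \<le> J"
  shows "integral\<^sup>L (surface_measure tr) g = J * (LINT x|surface_measure t0. g (\<Phi> x))"
proof -
  obtain k where k: "linear k" "k \<circ> L = id"
    using linear_injective_left_inverse[OF L(1,2)] by blast
  have inv: "k (\<Phi> x - d) = x" if "x \<in> flat_tri t0" for x
    using k(2) L(3)[OF that] by (simp add: fun_eq_iff)
  have img: "\<exists>x\<in>flat_tri t0. y = \<Phi> x" if "y \<in> flat_tri tr" for y
    using bij that by (auto simp: bij_betw_def)
  have "continuous_on UNIV (\<lambda>y. k (y - d))"
    by (intro continuous_intros linear_continuous_on_compose[OF _ k(1)])
  moreover have "(\<lambda>y. k (y - d)) ` flat_tri tr \<subseteq> flat_tri t0"
    using img inv by force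
  ultimately have h: "(\<lambda>y. k (y - d)) \<in> surface_measure tr \<rightarrow>\<^sub>M surface_measure t0"
    by (rule measurable_surface_measure)
  have "integral\<^sup>L (surface_measure tr) g =
      integral\<^sup>L (scale_measure (ennreal J) (distr (surface_measure t0) (surface_measure tr) \<Phi>)) g"
    using J(1) by (simp add: surface_jacobian_def)
  also have "\<dots> = J * integral\<^sup>L (distr (surface_measure t0) (surface_measure tr) \<Phi>) g"
    by (rule integral_scale_measure[OF J(2)])
  also have "integral\<^sup>L (distr (surface_measure t0) (surface_measure tr) \<Phi>) g =
      (LINT x|surface_measure t0. g (\<Phi> x))"
    by (intro integral_distr_isomorphism[OF _ h] measurable_affine_bijection[OF bij L(1,3)])
      (auto simp: space_surface_measure inv dest!: img)
  finally show ?thesis .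
qed

lemma borel_measurable_cross3:
  fixes f g :: "'a \<Rightarrow> real^3"
  assumes "f \<in> borel_measurable M" "g \<in> borel_measurable M"
  shows "(\<lambda>x. f x \<times> g x) \<in> borel_measurable M"
  using assms
  by (rule borel_measurable_continuous_Pair) (intro continuous_on_cross continuous_intros)

lemma rot_pairing_piola:
  assumes bij: "bij_betw \<Phi> (flat_tri t0) (flat_tri tr)"
    and L: "linear L" "L n0 = nr" "\<And>x. x \<in> flat_tri t0 \<Longrightarrow> \<Phi> x = L x + d"
    and F: "linear F" "\<And>x. x \<bullet> n0 = 0 \<Longrightarrow> F x = L x"
    and J: "surface_jacobian \<Phi> t0 tr J" "0 < J" "det (matrix L) = J"
    and u: "L2_tangential t0 n0 u" and v: "L2_tangential t0 n0 v"
  shows "rot_pairing tr nr (piola F J \<Phi> (flat_tri t0) u) (piola F J \<Phi> (flat_tri t0) v) =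
    rot_pairing t0 n0 u v"
proof -
  have inj: "inj L" using L(1) J by (simp flip: det_nz_iff_inj)
  have [measurable]: "u \<in> borel_measurable (surface_measure t0)" "v \<in> borel_measurable (surface_measure t0)"
    using u v by (auto simp: L2_tangential_def)
  have F_meas: "F \<in> borel_measurable borel"
    using F(1) by (intro borel_measurable_continuous_onI linear_continuous_on)
      (simp add: linear_conv_bounded_linear)
  have F_comp: "(\<lambda>x. F (w x)) \<in> borel_measurable (surface_measure t0)"
    if "w \<in> borel_measurable (surface_measure t0)" for w
    using measurable_compose[OF that F_meas] .
  have "rot_pairing tr nr (piola F J \<Phi> (flat_tri t0) u) (piola F J \<Phi> (flat_tri t0) v) =
    J * (LINT x|surface_measure t0.
       (piola F J \<Phi> (flat_tri t0) u (\<Phi> x) \<times> nr) \<bullet> piola F J \<Phi> (flat_tri t0) v (\<Phi> x))"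
    unfolding rot_pairing_def
    by (rule integral_surface_jacobian[OF bij L(1) inj L(3) J(1) less_imp_le[OF J(2)]])
  also have "(LINT x|surface_measure t0.
       (piola F J \<Phi> (flat_tri t0) u (\<Phi> x) \<times> nr) \<bullet> piola F J \<Phi> (flat_tri t0) v (\<Phi> x)) =
     (LINT x|surface_measure t0. (1 / J\<^sup>2) * ((F (u x) \<times> nr) \<bullet> F (v x)))"
    using bij
    by (intro Bochner_Integration.integral_cong refl)
      (simp add: piola_def space_surface_measure bij_betw_def inv_into_f_f cross_mult_left power2_eq_square)
  \<comment> \<open>\<open>F\<close> is known to agree with \<open>L\<close> on tangent vectors
    only, and \<open>u\<close> and \<open>v\<close> are tangential almost everywhere. The integrands
    are therefore compared almost everywhere, which calls for measurability of both.\<close>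
  also have "\<dots> = (LINT x|surface_measure t0. (1 / J) * ((u x \<times> n0) \<bullet> v x))"
  proof (rule integral_cong_AE)
    have "AE x in surface_measure t0. u x \<bullet> n0 = 0" "AE x in surface_measure t0. v x \<bullet> n0 = 0"
      using u v by (auto simp: L2_tangential_def)
    then show "AE x in surface_measure t0.
        (1 / J\<^sup>2) * ((F (u x) \<times> nr) \<bullet> F (v x)) = (1 / J) * ((u x \<times> n0) \<bullet> v x)"
    proof eventually_elim
      case (elim x)
      then show ?case
        using J(2,3) rot_triple_linear[OF L(1,2), of "u x" "v x"] by (simp add: F(2) power2_eq_square)
    qed
  qed (intro borel_measurable_times borel_measurable_const borel_measurable_inner
      borel_measurable_cross3 F_comp; measurable)+
  finally show ?thesis
    using J(2) by (simp add: rot_pairing_def)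
qed

theorem piola_rot_pairing_invariance:
  fixes \<Phi> F :: "real^3 \<Rightarrow> real^3"
  assumes t: "nondegenerate t0" "nondegenerate tr" and n: "is_unit_normal t0 n0" "is_unit_normal tr nr"
    and \<Phi>: "affine_bijection \<Phi> (flat_tri t0) (flat_tri tr)"
    and F: "tangential_differential \<Phi> (flat_tri t0) F"
    and J: "surface_jacobian \<Phi> t0 tr J"
  shows "bij_betw F (tangent_plane n0) (tangent_plane nr)"
    and "tangent_onb n0 e \<Longrightarrow> tangent_onb nr f \<Longrightarrow> \<bar>det_in_bases F e f\<bar> = J"
    and "J > 0"
    and "orientation_preserving F n0 nr \<Longrightarrow> positive_onb n0 e \<Longrightarrow> positive_onb nr f \<Longrightarrow>
      det_in_bases F e f = J"
    and "orientation_preserving F n0 nr \<Longrightarrow> L2_tangential t0 n0 u \<Longrightarrow> L2_tangential t0 n0 v \<Longrightarrow>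
      rot_pairing tr nr (piola F J \<Phi> (flat_tri t0) u) (piola F J \<Phi> (flat_tri t0) v) =
        rot_pairing t0 n0 u v"
proof -
  obtain L d where L: "linear L" "L n0 = nr" "\<And>x. L x \<bullet> nr = x \<bullet> n0"
    "\<And>x. x \<in> flat_tri t0 \<Longrightarrow> \<Phi> x = L x + d" and FL: "\<And>x. x \<bullet> n0 = 0 \<Longrightarrow> F x = L x"
    and det: "\<bar>det (matrix L)\<bar> * area_element t0 = area_element tr"
    using affine_bijection_flat_tri[OF t(1) n(1) t(2) n(2) \<Phi> F] by metis
  have bij: "bij_betw \<Phi> (flat_tri t0) (flat_tri tr)"
    using \<Phi> by (simp add: affine_bijection_def)
  have pos: "area_element t0 > 0" "area_element tr > 0"
    using t by (auto intro: area_element_pos)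
  have J_area: "J * area_element t0 = area_element tr"
    by (rule surface_jacobian_area[OF t bij L(1,4) J])
  then have J_det: "\<bar>det (matrix L)\<bar> = J" using det pos by (metis less_irrefl mult_right_cancel)
  show J_pos: "J > 0" using J_area pos by (metis zero_less_mult_pos2)
  show "bij_betw F (tangent_plane n0) (tangent_plane nr)"
    using J_pos J_det by (intro bij_betw_tangent_plane[OF L(1) _ L(3) FL]) auto
  have norms: "norm n0 = 1" "norm nr = 1"
    using n by (cases t0; cases tr; simp add: is_unit_normal_def)+
  have det_F: "det_in_bases F e f = det_in_bases L e f" if "tangent_onb n0 e" for e f
    using that by (simp add: det_in_bases_eq_cross FL tangent_onb_def tangent_plane_def)
  show abs_det: "\<bar>det_in_bases F e f\<bar> = J" if e: "tangent_onb n0 e" and f: "tangent_onb nr f" for e f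
  proof -
    \<comment> \<open>The determinant in the given bases is \<open>det (matrix L)\<close> times the
      two orientation signs, which disappear in the absolute value.\<close>
    obtain \<sigma> \<tau> where \<sigma>\<tau>: "\<bar>\<sigma>\<bar> = 1" "e $ 1 \<times> e $ 2 = \<sigma> *\<^sub>R n0" "\<bar>\<tau>\<bar> = 1" "f $ 1 \<times> f $ 2 = \<tau> *\<^sub>R nr"
      using tangent_onb_cross[OF norms(1) e] tangent_onb_cross[OF norms(2) f] by metis
    then show ?thesis
      using det_in_bases_linear[OF L(1,2) norms \<sigma>\<tau>(2,4)] \<sigma>\<tau>(1,3) J_det det_F[OF e]
      by (simp add: abs_mult)
  qed
  show det_pos: "det_in_bases F e f = J"
    if "orientation_preserving F n0 nr" "positive_onb n0 e" "positive_onb nr f" for e f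
  proof -
    have "det_in_bases F e f > 0" using that by (simp add: orientation_preserving_def)
    then show ?thesis using abs_det[of e f] that by (simp add: positive_onb_def)
  qed
  show "rot_pairing tr nr (piola F J \<Phi> (flat_tri t0) u) (piola F J \<Phi> (flat_tri t0) v) =
        rot_pairing t0 n0 u v"
    if "orientation_preserving F n0 nr" "L2_tangential t0 n0 u" "L2_tangential t0 n0 v" for u v
  proof (rule rot_pairing_piola[OF bij L(1,2,4) _ FL J J_pos _ that(2,3)])
    obtain e f where ef: "positive_onb n0 e" "positive_onb nr f"
      using positive_onb_exists t n by metis
    \<comment> \<open>In positive bases both signs are \<open>1\<close>, so the orientation
      hypothesis on \<open>F\<close> fixes the sign of \<open>det (matrix L)\<close>.\<close>
    then have "det_in_bases L e f = 1 * 1 * det (matrix L)"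
      by (intro det_in_bases_linear[OF L(1,2) norms]) (simp_all add: positive_onb_def)
    then show "det (matrix L) = J"
      using det_pos[OF that(1) ef] det_F ef(1) by (simp add: positive_onb_def)
    have "fst t0 \<in> flat_tri t0"
      by (cases t0) (simp add: flat_tri_def tri_verts_def hull_inc)
    then show "linear F"
      using F by (auto simp: tangential_differential_def intro: has_derivative_linear)
  qed
qed

section \<open>Invariance of the duality matrix\<close>

lemma is_unit_normal_oriented_normal:
  "nondegenerate t \<Longrightarrow> is_unit_normal t (oriented_normal t)"
  by (cases t) (simp add: nondegenerate_iff is_unit_normal_def oriented_normal_def dot_cross_self)

lemma tri_verts_map_tri: "tri_verts (map_tri f t) = f ` tri_verts t"
  by (cases t) (simp add: tri_verts_def map_tri_def)

lemma map_tri_comp: "map_tri f (map_tri g t) = map_tri (\<lambda>x. f (g x)) t"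
  by (cases t) (simp add: map_tri_def)

lemma map_tri_cong: "(\<And>v. v \<in> tri_verts t \<Longrightarrow> f v = g v) \<Longrightarrow> map_tri f t = map_tri g t"
  by (cases t) (simp add: tri_verts_def map_tri_def)

text \<open>With \<open>oriented_normal\<close>, the triple product of the two edges and the normal
  is the area element itself. So the determinant is the positive ratio of areas, with no absolute
  value.\<close>

lemma nondegenerate_affine_map:
  assumes "nondegenerate t" "nondegenerate t'"
  obtains L d where "linear L" "L (oriented_normal t) = oriented_normal t'"
    "\<And>x. L x \<bullet> oriented_normal t' = x \<bullet> oriented_normal t"
    "det (matrix L) * area_element t = area_element t'"
    "map_tri (\<lambda>x. L x + d) t = t'"
proof -
  obtain a b c a' b' c' where t: "t = (a, b, c)" and t': "t' = (a', b', c')"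
    by (cases t; cases t')
  let ?n = "oriented_normal t" and ?n' = "oriented_normal t'"
  have n: "norm ?n = 1" "(b - a) \<bullet> ?n = 0" "(c - a) \<bullet> ?n = 0"
    using is_unit_normal_oriented_normal[OF assms(1)] by (simp_all add: t is_unit_normal_def inner_commute)
  have n': "norm ?n' = 1" "(b' - a') \<bullet> ?n' = 0" "(c' - a') \<bullet> ?n' = 0"
    using is_unit_normal_oriented_normal[OF assms(2)] by (simp_all add: t' is_unit_normal_def inner_commute)
  have area: "((b - a) \<times> (c - a)) \<bullet> ?n = area_element t" "((b' - a') \<times> (c' - a')) \<bullet> ?n' = area_element t'"
    by (simp_all add: t t' oriented_normal_def area_element_def power2_norm_eq_inner[symmetric] power2_eq_square)
  have "((b - a) \<times> (c - a)) \<bullet> ?n \<noteq> 0"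
    using area_element_pos[OF assms(1)] area by simp
  from linear_tangent_extension[OF n this n'] obtain L where L: "linear L" "L (b - a) = b' - a'"
    "L (c - a) = c' - a'" "L ?n = ?n'" "\<And>x. L x \<bullet> ?n' = x \<bullet> ?n"
    "det (matrix L) * (((b - a) \<times> (c - a)) \<bullet> ?n) = ((b' - a') \<times> (c' - a')) \<bullet> ?n'"
    by metis
  have "map_tri (\<lambda>x. L x + (a' - L a)) t = t'"
    using L(2,3) by (simp add: t t' map_tri_def linear_diff[OF L(1)] algebra_simps)
  then show ?thesis
    using that[OF L(1,4,5)] L(6) area by simp
qed

lemma ref_map_affine:
  assumes "linear L"
  shows "ref_map (map_tri (\<lambda>x. L x + d) t) z = L (ref_map t z) + d"
    and "ref_diff (map_tri (\<lambda>x. L x + d) t) z = L (ref_diff t z)"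
  by (cases t; simp add: ref_map_def ref_diff_def map_tri_def linear_add[OF assms] linear_diff[OF assms]
      linear_scale[OF assms])+

text \<open>\<open>\<kappa>\<close> is the height of the plane of \<open>t\<close> along
  \<open>n\<close>. Fixing the plane instead of the triangle makes the same \<open>L\<close> serve a
  triangle and its barycentric subtriangles.\<close>

lemma area_element_affine:
  assumes "linear L" "L n = n'" "\<And>x. L x \<bullet> n' = x \<bullet> n" "norm n = 1" "norm n' = 1"
    and plane: "\<And>x. x \<in> tri_verts t \<Longrightarrow> x \<bullet> n = \<kappa>"
  shows "area_element (map_tri (\<lambda>x. L x + d) t) = \<bar>det (matrix L)\<bar> * area_element t"
proof -
  obtain a b c where t: "t = (a, b, c)" by (cases t)
  have "(b - a) \<bullet> n = 0" "(c - a) \<bullet> n = 0"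
    using plane by (simp_all add: t tri_verts_def inner_diff_left)
  from norm_cross_linear[OF assms(1-5) this] show ?thesis
    by (simp add: t area_element_def map_tri_def linear_diff[OF assms(1)])
qed

lemma flat_tri_affine:
  assumes "linear L"
  shows "flat_tri (map_tri (\<lambda>x. L x + d) t) = (\<lambda>x. L x + d) ` flat_tri t"
  by (simp add: flat_tri_eq_ref_map_image image_image ref_map_affine[OF assms])

lemma rel_interior_flat_tri_affine:
  assumes "linear L" "inj L"
  shows "L x + d \<in> rel_interior (flat_tri (map_tri (\<lambda>x. L x + d) t)) \<longleftrightarrow> x \<in> rel_interior (flat_tri t)"
proof -
  have "flat_tri (map_tri (\<lambda>x. L x + d) t) = (+) d ` L ` flat_tri t"
    by (simp add: flat_tri_affine[OF assms(1)] image_image) (simp add: add.commute)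
  then have "rel_interior (flat_tri (map_tri (\<lambda>x. L x + d) t)) = (+) d ` L ` rel_interior (flat_tri t)"
    using assms by (simp add: rel_interior_translation rel_interior_injective_linear_image
        linear_conv_bounded_linear)
  then show ?thesis
    using assms(2) by (auto simp: image_iff inj_eq add.commute)
qed

text \<open>Both integrals are pulled back to \<open>ref_tri\<close>, where corresponding points
  share a parameter: the integrand gains \<open>1 / k\<close>, the area element
  \<open>k\<close>.\<close>

lemma rot_pairing_affine:
  assumes L: "linear L" "L n = n'" "det (matrix L) = k" "k \<noteq> 0"
    and t: "nondegenerate t" "nondegenerate t'"
    and map: "map_tri (\<lambda>x. L x + d) t = t'" and area: "k * area_element t = area_element t'"
    and u: "\<And>x. u' (L x + d) = (1 / k) *\<^sub>R L (u x)"
    and v: "\<And>x. v' (L x + d) = (1 / k) *\<^sub>R L (v x)"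
  shows "rot_pairing t' n' u' v' = rot_pairing t n u v"
proof -
  have "(u' (ref_map t' z) \<times> n') \<bullet> v' (ref_map t' z) =
      (1 / k) * ((u (ref_map t z) \<times> n) \<bullet> v (ref_map t z))" for z
    using rot_triple_linear[OF L(1,2), of "u (ref_map t z)" "v (ref_map t z)"] L(3,4)
    by (simp flip: map add: ref_map_affine[OF L(1)] u v cross_mult_left)
  then show ?thesis
    using L(4) by (simp add: rot_pairing_def integral_surface_measure t flip: area)
qed

section \<open>RWG and BC functions under affine maps\<close>

lemma rwg_affine:
  assumes L: "linear L" "inj L" "L n = n'" "\<And>x. L x \<bullet> n' = x \<bullet> n" "norm n = 1" "norm n' = 1"
    "det (matrix L) = k" "0 < k"
    and map: "map_tri p' T = map_tri (\<lambda>x. L x + d) (map_tri p T)"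
    and plane: "\<And>v. v \<in> tri_verts T \<Longrightarrow> p v \<bullet> n = \<kappa>"
  shows "rwg p' \<omega> e T (L x + d) = (1 / k) *\<^sub>R L (rwg p \<omega> e T x)"
proof -
  let ?t = "map_tri p T"
  have area: "area_element (map_tri (\<lambda>x. L x + d) ?t) = k * area_element ?t"
    using area_element_affine[OF L(1,3-6), of ?t \<kappa> d] plane L(7,8)
    by (auto simp: tri_verts_map_tri)
  \<comment> \<open>Injectivity of \<open>L\<close> makes the two conditions under the choice
    operator identical. So the chosen parameters agree at every \<open>x\<close>, even off the
    triangle.\<close>
  have "inv_into ref_tri (ref_map (map_tri p' T)) (L x + d) = inv_into ref_tri (ref_map ?t) x"
    by (simp add: inv_into_def map ref_map_affine[OF L(1)] inj_eq[OF L(2)])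
  then show ?thesis
    by (simp add: rwg_def piola_def map area ref_map_affine[OF L(1)] linear_scale[OF L(1)] mult.commute)
qed

text \<open>The barycentric weights sum to \<open>1\<close>, so the translation passes through the
  average unchanged.\<close>

lemma bary_pos_affine:
  assumes "linear L" "finite s" "s \<noteq> {}" "\<And>v. v \<in> s \<Longrightarrow> p' v = L (p v) + d"
  shows "bary_pos p' s = L (bary_pos p s) + d"
proof -
  have "(\<Sum>v\<in>s. p' v) = L (\<Sum>v\<in>s. p v) + real (card s) *\<^sub>R d"
    using assms by (simp add: sum.distrib linear_sum scaleR_conv_of_real sum_constant_scaleR)
  then show ?thesis
    using assms by (simp add: bary_pos_def linear_scale scaleR_add_right)
qed

lemma bary_pos_inner:
  assumes "finite s" "s \<noteq> {}" "\<And>v. v \<in> s \<Longrightarrow> p v \<bullet> n = \<kappa>"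
  shows "bary_pos p s \<bullet> n = \<kappa>"
  using assms by (simp add: bary_pos_def inner_sum_left)

lemma bary_tri_verts:
  assumes "t \<in> bary_tri T" "s \<in> tri_verts t"
  shows "finite s" "s \<noteq> {}" "s \<subseteq> tri_verts T"
  using assms by (cases T; auto simp: bary_tri_def tri_verts_def)+

text \<open>The six subtriangles lie in the plane of \<open>T\<close> and their vertices are moved
  by the same affine map, so each summand scales with the same \<open>L\<close> and
  \<open>k\<close>.\<close>

lemma bary_rwg_affine:
  assumes L: "linear L" "inj L" "L n = n'" "\<And>x. L x \<bullet> n' = x \<bullet> n" "norm n = 1" "norm n' = 1"
    "det (matrix L) = k" "0 < k"
    and p': "\<And>v. v \<in> tri_verts T \<Longrightarrow> p' v = L (p v) + d"
    and plane: "\<And>v. v \<in> tri_verts T \<Longrightarrow> p v \<bullet> n = \<kappa>"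
  shows "bary_rwg p' bori f T (L x + d) = (1 / k) *\<^sub>R L (bary_rwg p bori f T x)"
proof -
  have map: "map_tri (bary_pos p') t = map_tri (\<lambda>x. L x + d) (map_tri (bary_pos p) t)"
    if "t \<in> bary_tri T" for t
    unfolding map_tri_comp using bary_tri_verts[OF that] p'
    by (intro map_tri_cong bary_pos_affine[OF L(1)]) blast+
  have plane': "bary_pos p s \<bullet> n = \<kappa>" if "t \<in> bary_tri T" "s \<in> tri_verts t" for s t
    using bary_tri_verts[OF that] plane by (intro bary_pos_inner) blast+
  show ?thesis
    unfolding bary_rwg_def linear_sum[OF L(1)] scaleR_sum_right
  proof (rule sum.cong[OF refl])
    fix t assume t: "t \<in> bary_tri T"
    show "(if L x + d \<in> rel_interior (flat_tri (map_tri (bary_pos p') t))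
         then rwg (bary_pos p') bori f t (L x + d) else 0) =
      (1 / k) *\<^sub>R L (if x \<in> rel_interior (flat_tri (map_tri (bary_pos p) t))
         then rwg (bary_pos p) bori f t x else 0)"
      using rwg_affine[OF L map[OF t] plane'[OF t]]
      by (simp add: map[OF t] rel_interior_flat_tri_affine[OF L(1,2)] linear_0[OF L(1)])
  qed
qed

lemma rot_pairing_rwg_bc_invariance:
  assumes t: "nondegenerate (map_tri p T)" "nondegenerate (map_tri p' T)"
  shows "rot_pairing (map_tri p' T) (oriented_normal (map_tri p' T)) (rwg p' \<omega> e T) (bc K p' bori C e' T) =
    rot_pairing (map_tri p T) (oriented_normal (map_tri p T)) (rwg p \<omega> e T) (bc K p bori C e' T)"
  (is "?lhs = ?rhs")
proof (rule nondegenerate_affine_map[OF t])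
  let ?t = "map_tri p T" and ?t' = "map_tri p' T"
  fix L d
  assume L: "linear L" "L (oriented_normal ?t) = oriented_normal ?t'"
    "\<And>x. L x \<bullet> oriented_normal ?t' = x \<bullet> oriented_normal ?t"
    and area: "det (matrix L) * area_element ?t = area_element ?t'"
    and map: "map_tri (\<lambda>x. L x + d) ?t = ?t'"
  have k: "det (matrix L) > 0"
    using area area_element_pos[OF t(1)] area_element_pos[OF t(2)] by (metis zero_less_mult_pos2)
  have inj: "inj L"
    using det_nz_iff_inj[OF L(1)] k by simp
  have n: "norm (oriented_normal ?t) = 1" "norm (oriented_normal ?t') = 1"
    using t by (auto dest!: is_unit_normal_oriented_normal simp: is_unit_normal_def split: prod.splits)
  obtain a b c where T: "T = (a, b, c)" by (cases T)
  have p': "p' v = L (p v) + d" if "v \<in> tri_verts T" for v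
    using map that by (auto simp: T map_tri_def tri_verts_def)
  \<comment> \<open>The height of the plane is read off at the vertex \<open>a\<close>.\<close>
  have plane: "p v \<bullet> oriented_normal ?t = p a \<bullet> oriented_normal ?t" if "v \<in> tri_verts T" for v
    using is_unit_normal_oriented_normal[OF t(1)] that
    by (auto simp: T map_tri_def tri_verts_def is_unit_normal_def inner_diff_right inner_commute)
  have rwg: "rwg p' \<omega> e T (L x + d) = (1 / det (matrix L)) *\<^sub>R L (rwg p \<omega> e T x)" for x
    by (rule rwg_affine[OF L(1) inj L(2,3) n refl k map[symmetric] plane])
  have bary: "bary_rwg p' bori f T (L x + d) = (1 / det (matrix L)) *\<^sub>R L (bary_rwg p bori f T x)" for f x
    by (rule bary_rwg_affine[OF L(1) inj L(2,3) n refl k p' plane])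
  have bc: "bc K p' bori C e' T (L x + d) = (1 / det (matrix L)) *\<^sub>R L (bc K p bori C e' T x)" for x
    unfolding bc_def linear_sum[OF L(1)] scaleR_sum_right
    by (intro sum.cong refl) (simp add: bary linear_scale[OF L(1)])
  show "?lhs = ?rhs"
    by (rule rot_pairing_affine[OF L(1,2) refl _ t map area]) (use k rwg bc in simp_all)
qed

section \<open>Matrix entries and relabelling\<close>

lemma N_XY_entry:
  assumes "same_connectivity M0 Mr" "same_edge_orientations M0 Mr" "bc_coeffs_from_connectivity M0 Mr"
    and "valid_discretisation M0" "valid_discretisation Mr"
    and e: "rwg_edge Mr i = rwg_edge M0 k" "bc_edge Mr j = bc_edge M0 l"
  shows "N_XY Mr $ i $ j = N_XY M0 $ k $ l"
proof -
  have tris: "tris Mr = tris M0" using assms(1) by (simp add: same_connectivity_def)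
  have edges: "rwg_edge M0 k \<in> edges (tris M0)" "bc_edge M0 l \<in> edges (tris M0)"
    using assms(4) by (auto simp: valid_discretisation_def bij_betw_def)
  \<comment> \<open>An RWG function sees the orientation only at its own edge, where the two meshes
    agree.\<close>
  have rwg: "rwg p (ori Mr) (rwg_edge M0 k) = rwg p (ori M0) (rwg_edge M0 k)" for p
    using edges assms(2) by (simp add: fun_eq_iff rwg_def same_edge_orientations_def)
  have "bary_rwg p (bary_ori Mr) f = bary_rwg p (bary_ori M0) f"
    if "f \<in> edges (bary_refinement (tris M0))" for p f
  proof -
    have "rwg q (bary_ori Mr) f = rwg q (bary_ori M0) f" for q
      using that assms(2) by (simp add: fun_eq_iff rwg_def same_edge_orientations_def)
    then show ?thesis by (simp only: fun_eq_iff bary_rwg_def) simp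
  qed
  then have bc: "bc (tris M0) p (bary_ori Mr) (bc_coeff Mr) (bc_edge M0 l) =
      bc (tris M0) p (bary_ori M0) (bc_coeff M0) (bc_edge M0 l)" for p
    using edges assms(3) by (auto simp: fun_eq_iff bc_def bc_coeffs_from_connectivity_def intro!: sum.cong)
  show ?thesis
    using assms(4,5)
    by (auto simp: N_XY_def e surface_pairing_def tris rwg bc valid_discretisation_def
        intro!: sum.cong rot_pairing_rwg_bc_invariance)
qed

text \<open>By injectivity, column \<open>i\<close> of the first relabelling is the unit vector at
  \<open>k\<close> and column \<open>j\<close> of the second the unit vector at \<open>l\<close>, so
  both sums collapse to one term.\<close>

lemma relabelling_conjugation_entry:
  fixes A :: "real^'j::finite^'i::finite"
  assumes "inj e" "inj f" "e' i = e k" "f' j = f l"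
  shows "(transpose (relabelling e e') ** A ** relabelling f f') $ i $ j = A $ k $ l"
proof -
  have "e' i = e m \<longleftrightarrow> k = m" "f' j = f m' \<longleftrightarrow> m' = l" for m m'
    using assms by (auto dest: injD)
  then show ?thesis
    by (simp add: matrix_matrix_mult_def transpose_def relabelling_def if_distrib if_distribR
        sum.delta sum.delta' cong: if_cong)
qed

theorem N_XY_relabelling:
  assumes "same_connectivity M0 Mr" "same_edge_orientations M0 Mr" "bc_coeffs_from_connectivity M0 Mr"
    and "valid_discretisation M0" "valid_discretisation Mr"
  shows "N_XY Mr = transpose (relabelling (rwg_edge M0) (rwg_edge Mr)) ** N_XY M0 **
      relabelling (bc_edge M0) (bc_edge Mr)"
proof -
  have tris: "tris Mr = tris M0" using assms(1) by (simp add: same_connectivity_def)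
  have inj: "inj (rwg_edge M0)" "inj (bc_edge M0)"
    and ran: "range (rwg_edge Mr) = range (rwg_edge M0)" "range (bc_edge Mr) = range (bc_edge M0)"
    using assms(4,5) by (auto simp: valid_discretisation_def bij_betw_def tris)
  show ?thesis
    unfolding vec_eq_iff
  proof (intro allI)
    fix i j
    \<comment> \<open>Both numberings exhaust the same edge set, so every perturbed index has a
      nominal partner.\<close>
    have "rwg_edge Mr i \<in> range (rwg_edge M0)" "bc_edge Mr j \<in> range (bc_edge M0)"
      by (simp_all flip: ran)
    then obtain k l where kl: "rwg_edge Mr i = rwg_edge M0 k" "bc_edge Mr j = bc_edge M0 l"
      by blast
    have "(transpose (relabelling (rwg_edge M0) (rwg_edge Mr)) ** N_XY M0 **
        relabelling (bc_edge M0) (bc_edge Mr)) $ i $ j = N_XY M0 $ k $ l"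
      by (rule relabelling_conjugation_entry) (fact inj kl)+
    with N_XY_entry[OF assms kl] show "N_XY Mr $ i $ j =
        (transpose (relabelling (rwg_edge M0) (rwg_edge Mr)) ** N_XY M0 **
          relabelling (bc_edge M0) (bc_edge Mr)) $ i $ j"
      by simp
  qed
qed

theorem lemma14:
  fixes t0 tr :: "(real^3) tri"
    and n0 nr :: "real^3"
    and \<Phi> F :: "real^3 \<Rightarrow> real^3"
    and J :: real
    and M0 Mr :: "('v, 'i::finite, 'j::finite) discretised_surface"
  shows
    "(nondegenerate t0 \<and> nondegenerate tr \<and>
      is_unit_normal t0 n0 \<and> is_unit_normal tr nr \<and>
      affine_bijection \<Phi> (flat_tri t0) (flat_tri tr) \<and>
      tangential_differential \<Phi> (flat_tri t0) F \<and>
      surface_jacobian \<Phi> t0 tr J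
      \<longrightarrow>
      bij_betw F (tangent_plane n0) (tangent_plane nr) \<and>
      (\<forall>e f. tangent_onb n0 e \<and> tangent_onb nr f \<longrightarrow> \<bar>det_in_bases F e f\<bar> = J) \<and>
      (orientation_preserving F n0 nr \<longrightarrow>
        J > 0 \<and>
        (\<forall>e f. positive_onb n0 e \<and> positive_onb nr f \<longrightarrow> det_in_bases F e f = J) \<and>
        (\<forall>u v. L2_tangential t0 n0 u \<and> L2_tangential t0 n0 v \<longrightarrow>
          rot_pairing tr nr (piola F J \<Phi> (flat_tri t0) u) (piola F J \<Phi> (flat_tri t0) v)
            = rot_pairing t0 n0 u v)))
     \<and>
     (valid_discretisation M0 \<and> embedded (tris M0) (pos M0) \<and>
      valid_discretisation Mr \<and>
      same_connectivity M0 Mr \<and> same_edge_orientations M0 Mr \<and>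
      elementwise_affine M0 Mr \<and>
      bc_coeffs_from_connectivity M0 Mr
      \<longrightarrow>
      N_XY Mr =
        transpose (relabelling (rwg_edge M0) (rwg_edge Mr)) ** N_XY M0 **
          relabelling (bc_edge M0) (bc_edge Mr))"
proof -
  note * = piola_rot_pairing_invariance[of t0 tr n0 nr \<Phi> F J]
  show ?thesis
    by (intro conjI impI allI; elim conjE; rule * N_XY_relabelling; assumption)
qed

end
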